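(* For every integer $n\ge 1$, $|\mathcal{S}_n(31;\,1\to 2)| = B_n$, where $B_n$ is the $n$-th Bell number.
   Context: $[n]=\{1,\dots,n\}$, and $\mathcal{S}_n$ is the set of permutations $\pi=\pi_1\pi_2\cdots\pi_n$ of $[n]$ in one-line notation. The permutation $\hat\pi$: for $\pi\in\mathcal{S}_n$, $\hat\pi\in\mathcal{S}_n$ is the permutation whose cycle form is obtained from the word $\pi_1\cdots\pi_n$ by inserting a left parenthesis before each left-to-right maximum (an entry larger than all entries to its left) and a right parenthesis immediately before the next left-to-right maximum, or at the end of the word. A cycle $(c_1,c_2,\dots,c_s)$ means $c_1\mapsto c_2\mapsto\cdots\mapsto c_s\mapsto c_1$. Example: if $\pi=2537164$ then $\hat\pi=(2)(53)(7164)$. Arrow patterns: an arrow pattern of size $k$ is a pair $(\nu;H)$ where $\nu=\nu_1\cdots\nu_m$ is a word of distinct positive integers, $H$ is a collection of arrows $b_i\to c_i$, and the set of all integers appearing in $\nu$ or $H$ is $[k]$. A permutation $\pi\in\mathcal{S}_n$ contains $(\nu;H)$ if there are a set $X=\{x_1<x_2<\cdots<x_k\}\subseteq[n]$ and indices $t_1<\cdots<t_m$ such that $\pi_{t_1}\pi_{t_2}\cdots\pi_{t_m}=x_{\nu_1}x_{\nu_2}\cdots x_{\nu_m}$ and $\hat\pi(x_{b_i})=x_{c_i}$ for every arrow $b_i\to c_i$ in $H$. Otherwise $\pi$ avoids $(\nu;H)$. $\mathcal{S}_n(\nu;H)$ is the set of permutations in $\mathcal{S}_n$ avoiding $(\nu;H)$.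 The Bell number $B_n$ is the number of set partitions of $[n]$. *)

theory Defs
  imports "HOL-Combinatorics.Combinatorics" "HOL-Library.Disjoint_Sets"
begin

text \<open>
  A permutation of \<open>[n]\<close> in one-line notation is a list in
  \<^term>\<open>permutations_of_set {1..n::nat}\<close>.  Entries are \<open>1, \<dots>, n\<close>; list positions count from \<open>0\<close>.
\<close>

definition is_ltr_max :: "nat list \<Rightarrow> nat \<Rightarrow> bool" where
  "is_ltr_max w i \<longleftrightarrow> i < length w \<and> (\<forall>j<i. w ! j < w ! i)"

definition ltr_max_positions :: "nat list \<Rightarrow> nat list" where
  "ltr_max_positions w = filter (is_ltr_max w) [0..<length w]"

text \<open>
  The cycle form: each left-to-right maximum opens a parenthesis, which is closed just before
  the next left-to-right maximum, or at the end of the word.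
\<close>

definition hat_cycles :: "nat list \<Rightarrow> nat list list" where
  "hat_cycles w =
     (let ps = ltr_max_positions w
      in map2 (\<lambda>p q. take (q - p) (drop p w)) ps (tl ps @ [length w]))"

text \<open>
  The cycles are pairwise disjoint when \<open>w\<close> has distinct entries, so the order of composition
  does not matter.  \<^term>\<open>cycle_of_list cs\<close> sends each entry of \<open>cs\<close> to the next one
  and the last entry to the first.
\<close>

definition hat :: "nat list \<Rightarrow> nat \<Rightarrow> nat" where
  "hat w = foldr (\<lambda>cs f. cycle_of_list cs \<circ> f) (hat_cycles w) id"

lemma hat_cycles_example: "hat_cycles [2,5,3,7,1,6,4] = [[2],[5,3],[7,1,6,4]]"
  by code_simp

lemma hat_example: "map (hat [2,5,3,7,1,6,4]) [1,2,3,4,5,6,7] = [6,2,5,7,3,4,1]"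
  unfolding hat_def hat_cycles_example by (simp add: transpose_def)

text \<open>In \<open>(\<nu>, H)\<close>, a pair \<open>(b, c) \<in> H\<close> is the arrow \<open>b \<rightarrow> c\<close>.\<close>

type_synonym arrow_pattern = "nat list \<times> (nat \<times> nat) set"

definition letters :: "arrow_pattern \<Rightarrow> nat set" where
  "letters p = set (fst p) \<union> fst ` snd p \<union> snd ` snd p"

definition pattern_size :: "arrow_pattern \<Rightarrow> nat" where
  "pattern_size p = card (letters p)"

definition is_arrow_pattern :: "arrow_pattern \<Rightarrow> bool" where
  "is_arrow_pattern p \<longleftrightarrow> distinct (fst p) \<and> finite (snd p) \<and> letters p = {1..pattern_size p}"

text \<open>
  The set \<open>X = {x\<^sub>1 < \<dots> < x\<^sub>k}\<close> is given by its increasing enumeration \<open>x\<close>, and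
  the increasing sequence of positions of the occurrence of \<open>\<nu>\<close> by \<open>t\<close>.  Only the values
  of \<open>x\<close> on \<open>{1..k}\<close> and of \<open>t\<close> below \<open>length \<nu>\<close> matter.
\<close>

definition contains_arrow :: "nat list \<Rightarrow> arrow_pattern \<Rightarrow> bool" where
  "contains_arrow w p \<longleftrightarrow>
     (\<exists>x t. strict_mono_on {1..pattern_size p} x \<and> x ` {1..pattern_size p} \<subseteq> {1..length w} \<and>
            strict_mono_on {..<length (fst p)} t \<and> t ` {..<length (fst p)} \<subseteq> {..<length w} \<and>
            (\<forall>j<length (fst p). w ! t j = x (fst p ! j)) \<and>
            (\<forall>(b, c)\<in>snd p. hat w (x b) = x c))"

definition avoiders :: "nat \<Rightarrow> arrow_pattern \<Rightarrow> nat list set" where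
  "avoiders n p = {w \<in> permutations_of_set {1..n}. \<not> contains_arrow w p}"

definition bell :: "nat \<Rightarrow> nat" where
  "bell n = card {P. partition_on {1..n} P}"

lemma is_arrow_pattern_31_12: "is_arrow_pattern ([3, 1], {(1, 2)})"
proof -
  have l: "letters ([3, 1], {(1, 2)}) = {1, 2, 3}"
    by (auto simp: letters_def)
  moreover have "{1, 2, 3} = {1..3::nat}"
    by auto
  ultimately show ?thesis
    by (simp add: is_arrow_pattern_def pattern_size_def)
qed

end

(*
  Cut the word w into its blocks, the cycles of hat w in one-line order; each is opened by a
  left-to-right maximum.  If a is the last entry of its block, then hat w sends a to the
  maximum of the block, which no earlier entry exceeds, so a is not the letter 1 of an
  occurrence.  Otherwise a is sent to the next entry b of the block, and if a < b then the
  opening maximum is larger than b and precedes a: an occurrence.  Hence w avoids the pattern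
  iff all its blocks are decreasing, and such words correspond to set partitions: list the
  parts by increasing maximum, each part in decreasing order.
*)
theory Submission
  imports Defs
begin

section \<open>Words cut at their left-to-right maxima\<close>

text \<open>An intrinsic description of the lists that \<open>hat_cycles\<close> produces: the heads
  of the blocks are exactly the left-to-right maxima of \<open>concat L\<close>. The bound inside a
  block is weak because a repeated maximum opens no new block.\<close>

definition cycle_blocks :: "nat list list \<Rightarrow> bool" where
  "cycle_blocks L \<longleftrightarrow>
     (\<forall>c\<in>set L. c \<noteq> [] \<and> (\<forall>y\<in>set c. y \<le> hd c)) \<and> sorted_wrt (\<lambda>c d. hd c < hd d) L"

lemma cycle_blocks_snoc:
  "cycle_blocks (L @ [c]) \<longleftrightarrow>
     cycle_blocks L \<and> c \<noteq> [] \<and> (\<forall>y\<in>set c. y \<le> hd c) \<and> (\<forall>d\<in>set L. hd d < hd c)"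
  by (auto simp: cycle_blocks_def sorted_wrt_append)

lemma cycle_blocks_le_hd:
  assumes "cycle_blocks L" "c \<in> set L" "y \<in> set c"
  shows "y \<le> hd c"
  using assms by (simp add: cycle_blocks_def)

text \<open>Each head bounds its block and the heads increase, so the last head is the maximum of
  the whole word. Applied to an initial run of blocks, this compares an opening maximum with
  everything before it.\<close>

lemma cycle_blocks_snoc_le:
  assumes "cycle_blocks (L @ [c])" "y \<in> set (concat (L @ [c]))"
  shows "y \<le> hd c"
proof (cases "y \<in> set c")
  case True
  with assms(1) show ?thesis by (auto intro: cycle_blocks_le_hd)
next
  case False
  then obtain d where d: "d \<in> set L" "y \<in> set d" using assms(2) by auto
  then have "y \<le> hd d" using assms(1) by (auto intro: cycle_blocks_le_hd)
  also have "hd d < hd c" using assms(1) d(1) by (simp add: cycle_blocks_snoc)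
  finally show ?thesis by simp
qed

text \<open>Being a left-to-right maximum depends only on the entries up to that position, so
  nothing changes inside \<open>w\<close>; the head of \<open>c\<close> beats all of
  \<open>w\<close>, and no later entry of \<open>c\<close> beats this head.\<close>

lemma ltr_max_positions_append_block:
  assumes "c \<noteq> []" "\<forall>y\<in>set c. y \<le> hd c" "\<forall>y\<in>set w. y < hd c"
  shows "ltr_max_positions (w @ c) = ltr_max_positions w @ [length w]"
proof -
  obtain m c' where c: "c = m # c'" using assms(1) by (cases c) auto
  have 1: "filter (is_ltr_max (w @ c)) [0..<length w] = filter (is_ltr_max w) [0..<length w]"
    by (intro filter_cong) (auto simp: is_ltr_max_def nth_append)
  have 2: "is_ltr_max (w @ c) (length w)"
    using assms(3) by (auto simp: is_ltr_max_def nth_append c)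
  have 3: "filter (is_ltr_max (w @ c)) [Suc (length w)..<length w + length c] = []"
  proof (clarsimp simp: filter_empty_conv)
    fix i assume i: "Suc (length w) \<le> i" "i < length w + length c" and "is_ltr_max (w @ c) i"
    then have "(w @ c) ! length w < (w @ c) ! i" by (auto simp: is_ltr_max_def)
    moreover have "c ! (i - length w) \<le> hd c" using assms(2) i by (auto simp: c intro!: nth_mem)
    ultimately show False using i by (simp add: nth_append c)
  qed
  have "[0..<length (w @ c)] = [0..<length w] @ length w # [Suc (length w)..<length w + length c]"
    using assms(1) upt_add_eq_append[of 0 "length w" "length c"] by (simp add: upt_conv_Cons)
  then show ?thesis
    using 1 2 3 by (simp add: ltr_max_positions_def)
qed

lemma hat_cycles_append_block:
  assumes "c \<noteq> []" "\<forall>y\<in>set c. y \<le> hd c" "\<forall>y\<in>set w. y < hd c"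
  shows "hat_cycles (w @ c) = hat_cycles w @ [c]"
proof -
  define ps where "ps = ltr_max_positions w"
  have ps: "\<forall>p\<in>set ps. p < length w" by (auto simp: ps_def ltr_max_positions_def)
  show ?thesis
  \<comment> \<open>For nonempty \<open>ps\<close> the tail of \<open>ps @ [length w]\<close> is
    \<open>tl ps @ [length w]\<close>, so the old end marker becomes the start of the new block.
    Empty \<open>ps\<close> forces \<open>w\<close> to be empty, since position 0 is always a
    left-to-right maximum.\<close>
  proof (cases "ps = []")
    case True
    have "w = []"
    proof (rule ccontr)
      assume "w \<noteq> []"
      then have "0 \<in> set ps" by (auto simp: ps_def ltr_max_positions_def is_ltr_max_def)
      with True show False by simp
    qed
    then show ?thesis
      using ltr_max_positions_append_block[OF assms] by (simp add: hat_cycles_def ltr_max_positions_def)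
  next
    case False
    define qs where "qs = tl ps @ [length w]"
    have len: "length ps = length qs" using False by (simp add: qs_def)
    have qs: "\<forall>q\<in>set qs. q \<le> length w"
      using ps False by (auto simp: qs_def dest!: list.set_sel(2) intro: less_imp_le)
    have "hat_cycles (w @ c) =
        map2 (\<lambda>p q. take (q - p) (drop p (w @ c))) (ps @ [length w]) (qs @ [length w + length c])"
      using ltr_max_positions_append_block[OF assms] False
      by (simp add: hat_cycles_def ps_def[symmetric] qs_def)
    also have "\<dots> = map2 (\<lambda>p q. take (q - p) (drop p (w @ c))) ps qs @ [c]"
      using len by simp
    \<comment> \<open>All these slices end at or before \<open>length w\<close>, so they do not
      reach into \<open>c\<close>.\<close>
    also have "map2 (\<lambda>p q. take (q - p) (drop p (w @ c))) ps qs =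
        map2 (\<lambda>p q. take (q - p) (drop p w)) ps qs"
      using ps qs by (intro map_cong) (fastforce dest!: set_zip_leftD set_zip_rightD
        simp: diff_le_mono)+
    also have "\<dots> = hat_cycles w"
      by (simp add: hat_cycles_def Let_def ps_def[symmetric] qs_def)
    finally show ?thesis .
  qed
qed

lemma hat_cycles_concat: "cycle_blocks L \<Longrightarrow> hat_cycles (concat L) = L"
proof (induction L rule: rev_induct)
  case Nil
  show ?case by (simp add: hat_cycles_def ltr_max_positions_def)
next
  case (snoc c L)
  then have L: "cycle_blocks L" and c: "c \<noteq> []" "\<forall>y\<in>set c. y \<le> hd c"
    and less: "\<forall>d\<in>set L. hd d < hd c"
    by (auto simp: cycle_blocks_snoc)
  have "\<forall>y\<in>set (concat L). y < hd c"
    using cycle_blocks_le_hd[OF L] less by (auto intro: le_less_trans)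
  from hat_cycles_append_block[OF c this] show ?case
    using snoc.IH[OF L] by simp
qed

text \<open>Greedy reading from left to right: an entry larger than all earlier ones opens a block,
  any other entry joins the last block, whose head is the maximum so far.\<close>

lemma ex_cycle_blocks: "\<exists>L. cycle_blocks L \<and> concat L = w"
proof (induction w rule: rev_induct)
  case Nil
  show ?case by (intro exI[of _ "[]"]) (simp add: cycle_blocks_def)
next
  case (snoc x w)
  then obtain L where L: "cycle_blocks L" "concat L = w" by blast
  show ?case
  proof (cases "\<forall>y\<in>set w. y < x")
    case True
    then have "\<forall>d\<in>set L. hd d < x"
      using L by (force simp: cycle_blocks_def intro: hd_in_set)
    then have "cycle_blocks (L @ [[x]])" using L by (simp add: cycle_blocks_snoc)
    with L(2) show ?thesis by (intro exI[of _ "L @ [[x]]"]) simp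
  next
    case False
    then have "L \<noteq> []" using L(2) by auto
    then obtain M c where M: "L = M @ [c]" by (metis rev_exhaust)
    from False obtain y where y: "y \<in> set w" "x \<le> y" by (auto simp: not_less)
    have "y \<le> hd c"
      using y(1) L unfolding M by (intro cycle_blocks_snoc_le[of M]) simp_all
    with y(2) have "cycle_blocks (M @ [c @ [x]])"
      using L(1) unfolding M by (auto simp: cycle_blocks_snoc)
    with L(2) show ?thesis unfolding M by (intro exI[of _ "M @ [c @ [x]]"]) simp
  qed
qed

section \<open>The action of \<open>hat\<close> on a block\<close>

lemma cycle_of_list_nth:
  assumes "distinct c" "i < length c"
  shows "cycle_of_list c (c ! i) = c ! (Suc i mod length c)"
proof -
  have "map (cycle_of_list c) c = rotate1 c"
    using cyclic_rotation[OF assms(1), of 1] by simp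
  then have "map (cycle_of_list c) c ! i = rotate1 c ! i" by simp
  with assms(2) show ?thesis by (simp add: nth_rotate1)
qed

text \<open>The cycles have disjoint supports, so only the one containing \<open>a\<close> acts:
  those applied before it fix \<open>a\<close>, those applied after it fix the image of
  \<open>a\<close>.\<close>

lemma foldr_cycles_apply:
  assumes "distinct (concat L)" "c \<in> set L" "a \<in> set c"
  shows "foldr (\<lambda>cs f. cycle_of_list cs \<circ> f) L id a = cycle_of_list c a"
  using assms
proof (induction L)
  case (Cons d L)
  have outside: "foldr (\<lambda>cs f. cycle_of_list cs \<circ> f) M id b = b" if "b \<notin> set (concat M)" for M b
    using that by (induction M) (auto simp: id_outside_supp)
  show ?case
  proof (cases "c \<in> set L")
    case True
    \<comment> \<open>The image stays in \<open>c\<close>, hence outside \<open>d\<close>, which is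
      applied last and fixes it.\<close>
    have "cycle_of_list c a \<in> set c"
      using Cons.prems(2,3) True
      by (metis cycle_permutes permutes_in_image)
    then have "cycle_of_list c a \<notin> set d" using True Cons.prems by auto
    then show ?thesis using Cons True by (simp add: id_outside_supp)
  next
    case False
    then have "c = d" using Cons.prems by simp
    with Cons.prems have "a \<notin> set (concat L)" by auto
    from outside[OF this] \<open>c = d\<close> show ?thesis
      unfolding foldr.simps comp_apply by simp
  qed
qed simp

lemma hat_concat_nth:
  assumes "cycle_blocks L" "distinct (concat L)" "c \<in> set L" "i < length c"
  shows "hat (concat L) (c ! i) = c ! (Suc i mod length c)"
proof -
  have "distinct c" using assms(2,3) by (auto simp: distinct_concat_iff)
  then show ?thesis
    using assms by (simp add: hat_def hat_cycles_concat foldr_cycles_apply cycle_of_list_nth)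
qed

section \<open>Occurrences of the pattern\<close>

text \<open>The letters 1, 2, 3 are played by \<open>w ! j\<close>, its image under
  \<open>hat w\<close>, and \<open>w ! i\<close>. The range condition mentions only the outer two,
  because the image lies between them.\<close>

lemma contains_arrow_31_12:
  "contains_arrow w ([3, 1], {(1, 2)}) \<longleftrightarrow>
     (\<exists>i j. i < j \<and> j < length w \<and> w ! j < hat w (w ! j) \<and> hat w (w ! j) < w ! i \<and>
            {w ! j, w ! i} \<subseteq> {1..length w})"
proof -
  have size: "pattern_size ([3, 1], {(1, 2)}) = 3"
    by (simp add: pattern_size_def letters_def card_insert_if)
  have 3: "{1..3} = {1, 2, 3::nat}" by auto
  have 2: "{..<length [3, 1::nat]} = {0, 1}" by auto
  have all: "(\<forall>j<length [3, 1::nat]. P j) \<longleftrightarrow> P 0 \<and> P 1" for P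
    by (auto simp: less_Suc_eq numeral_2_eq_2)
  show ?thesis (is "?L \<longleftrightarrow> ?R")
  proof
    assume ?L
    then obtain x t :: "nat \<Rightarrow> nat" where x: "strict_mono_on {1, 2, 3} x" "x ` {1, 2, 3} \<subseteq> {1..length w}"
      and t: "strict_mono_on {0, 1} t" "t ` {0, 1} \<subseteq> {..<length w}"
      and *: "w ! t 0 = x 3" "w ! t 1 = x 1" "hat w (x 1) = x 2"
      unfolding contains_arrow_def size fst_conv snd_conv 3 2 all by (auto simp del: One_nat_def)
    have "x 1 < x 2" "x 2 < x 3" "t 0 < t 1"
      using x(1) t(1) by (auto simp: strict_mono_on_def)
    with x(2) t(2) * show ?R by (intro exI[of _ "t 0"] exI[of _ "t 1"]) auto
  next
    assume ?R
    then obtain i j where ij: "i < j" "j < length w" "w ! j < hat w (w ! j)"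
      "hat w (w ! j) < w ! i" "{w ! j, w ! i} \<subseteq> {1..length w}"
      by blast
    define x where "x = (\<lambda>k::nat. if k = 1 then w ! j else if k = 2 then hat w (w ! j) else w ! i)"
    define t where "t = (\<lambda>k::nat. if k = 0 then i else j)"
    show ?L
      unfolding contains_arrow_def size fst_conv snd_conv 3 2 all
      using ij
      by (intro exI[of _ x] exI[of _ t]) (auto simp: x_def t_def strict_mono_on_def)
  qed
qed

lemma contains_arrow_concat_iff:
  assumes L: "cycle_blocks L" "distinct (concat L)" and set: "set (concat L) = {1..n}"
  shows "contains_arrow (concat L) ([3, 1], {(1, 2)}) \<longleftrightarrow> \<not> (\<forall>c\<in>set L. sorted_wrt (>) c)"
proof -
  define w where "w = concat L"
  have len: "length w = n"
    using distinct_card[OF L(2)] set by (simp add: w_def)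
  have range: "{w ! j, w ! i} \<subseteq> {1..length w}" if "i < length w" "j < length w" for i j
    using nth_mem[OF that(1)] nth_mem[OF that(2)] set unfolding len w_def[symmetric] by simp
  have "(\<exists>i j. i < j \<and> j < length w \<and> w ! j < hat w (w ! j) \<and> hat w (w ! j) < w ! i)
      \<longleftrightarrow> \<not> (\<forall>c\<in>set L. sorted_wrt (>) c)" (is "?A \<longleftrightarrow> \<not> ?B")
  proof
    assume ?A
    then obtain i j where ij: "i < j" "j < length w" "w ! j < hat w (w ! j)"
      "hat w (w ! j) < w ! i" by blast
    from ij(2) have "w ! j \<in> set (concat L)" unfolding w_def by (rule nth_mem)
    then obtain c where c: "c \<in> set L" "w ! j \<in> set c" by auto
    then obtain L1 L2 where split: "L = L1 @ c # L2" by (meson split_list)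
    from c(2) obtain k where k: "k < length c" "c ! k = w ! j" by (auto simp: in_set_conv_nth)
    \<comment> \<open>Entries are distinct, so this equality of values fixes the position
      \<open>j\<close>; then \<open>i < j\<close> places \<open>w ! i\<close> in the blocks up to
      and including \<open>c\<close>.\<close>
    have "w ! (length (concat L1) + k) = w ! j"
      using k by (simp add: w_def split nth_append)
    moreover have "length (concat L1) + k < length w" using k by (simp add: w_def split)
    ultimately have j: "j = length (concat L1) + k"
      using ij(2) L(2) unfolding w_def by (metis nth_eq_iff_index_eq)
    have i: "i < length (concat L1 @ c)" using ij(1) k j by simp
    have "w = (concat L1 @ c) @ concat L2" by (simp add: w_def split)
    with i have "w ! i \<in> set (concat L1 @ c)" by (metis nth_append nth_mem)
    moreover have "cycle_blocks (L1 @ [c])"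
      using L(1) by (auto simp: split cycle_blocks_def sorted_wrt_append)
    ultimately have le: "w ! i \<le> hd c"
      by (intro cycle_blocks_snoc_le[of L1]) simp_all
    have hat: "hat w (w ! j) = c ! (Suc k mod length c)"
      using hat_concat_nth[OF L c(1) k(1)] k(2) by (simp add: w_def)
    have "Suc k \<noteq> length c"
    proof
      assume "Suc k = length c"
      then have "hat w (w ! j) = hd c" using hat k by (cases c) auto
      with ij(4) le show False by simp
    qed
    with k(1) have "Suc k < length c" by simp
    moreover from this have "c ! k < c ! Suc k" using ij(3) hat k(2) by simp
    ultimately show "\<not> ?B" using c(1) by (auto dest!: sorted_wrt_nth_less[of _ _ k "Suc k"])
  next
    assume "\<not> ?B"
    then obtain c where c: "c \<in> set L" "\<not> sorted_wrt (>) c" by blast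
    have dist: "distinct c" using L(2) c(1) by (auto simp: distinct_concat_iff)
    \<comment> \<open>By transitivity of \<open>>\<close>, a failure to decrease already shows at
      two adjacent entries.\<close>
    from c(2) obtain k where k: "Suc k < length c" "c ! k \<le> c ! Suc k"
      by (auto simp: sorted_wrt_iff_nth_Suc_transp transp_on_def not_less)
    have lt: "c ! k < c ! Suc k"
      using k dist by (metis Suc_lessD le_neq_implies_less n_not_Suc_n nth_eq_iff_index_eq)
    have hd: "c ! 0 = hd c" using k by (cases c) auto
    have "c ! Suc k \<le> c ! 0" using L(1) c(1) k unfolding hd by (auto simp: cycle_blocks_def)
    moreover have "c ! Suc k \<noteq> c ! 0" using dist k by (subst nth_eq_iff_index_eq) auto
    ultimately have lt': "c ! Suc k < c ! 0" by simp
    from c(1) obtain L1 L2 where split: "L = L1 @ c # L2" by (meson split_list)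
    define p where "p = length (concat L1)"
    have nth: "w ! (p + l) = c ! l" if "l < length c" for l
      using that by (simp add: w_def split p_def nth_append)
    have "hat w (c ! k) = c ! Suc k"
      using hat_concat_nth[OF L c(1), of k] k(1) by (simp add: w_def)
    \<comment> \<open>This puts the opening maximum, at position \<open>p\<close>, strictly before
      the ascent, so it can serve as the letter 3.\<close>
    moreover have "k \<noteq> 0" using lt lt' by (cases k) auto
    moreover have "p + k < length w" using k by (simp add: w_def split p_def)
    moreover have "w ! (p + k) = c ! k" "w ! p = c ! 0"
      using k(1) nth[of k] nth[of 0] by fastforce+
    ultimately show ?A
      using lt lt'
      by (intro exI[of _ p] exI[of _ "p + k"]) auto
  qed
  then show ?thesis
    unfolding contains_arrow_31_12 w_def[symmetric] using range by (meson order.strict_trans)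
qed

section \<open>Avoiders and set partitions\<close>

text \<open>The intermediate set of the count: concatenating the blocks gives the avoiders,
  forgetting all order gives the set partitions.\<close>

definition decreasing_blocks :: "nat \<Rightarrow> nat list list set" where
  "decreasing_blocks n =
     {L. cycle_blocks L \<and> distinct (concat L) \<and> set (concat L) = {1..n} \<and>
         (\<forall>c\<in>set L. sorted_wrt (>) c)}"

text \<open>The inverse is \<open>hat_cycles\<close>. Every word arises from some block list, and
  the avoidance criterion selects those with decreasing blocks.\<close>

lemma bij_betw_concat_avoiders:
  "bij_betw concat (decreasing_blocks n) (avoiders n ([3, 1], {(1, 2)}))"
  unfolding bij_betw_def
proof
  show "inj_on concat (decreasing_blocks n)"
    by (rule inj_on_inverseI[of _ hat_cycles]) (simp add: decreasing_blocks_def hat_cycles_concat)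
  show "concat ` decreasing_blocks n = avoiders n ([3, 1], {(1, 2)})"
  proof (intro equalityI subsetI)
    fix w assume "w \<in> concat ` decreasing_blocks n"
    then obtain L where "w = concat L" "L \<in> decreasing_blocks n" by blast
    then show "w \<in> avoiders n ([3, 1], {(1, 2)})"
      using contains_arrow_concat_iff[of L n]
      by (auto simp: decreasing_blocks_def avoiders_def permutations_of_set_def simp del: set_concat)
  next
    fix w assume w: "w \<in> avoiders n ([3, 1], {(1, 2)})"
    obtain L where "cycle_blocks L" "concat L = w" using ex_cycle_blocks by blast
    with w have "L \<in> decreasing_blocks n"
      using contains_arrow_concat_iff[of L n]
      by (auto simp: decreasing_blocks_def avoiders_def permutations_of_set_def simp del: set_concat)
    with \<open>concat L = w\<close> show "w \<in> concat ` decreasing_blocks n" by blast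
  qed
qed

lemma decreasing_eq_rev_sorted_list_of_set:
  fixes c :: "'a::linorder list"
  assumes "sorted_wrt (>) c"
  shows "c = rev (sorted_list_of_set (set c))"
proof -
  have "sorted_wrt (<) (rev c)" using assms by (simp add: sorted_wrt_rev)
  then have "sorted_list_of_set (set (rev c)) = rev c"
    by (metis sorted_list_of_set.idem_if_sorted_distinct strict_sorted_iff)
  then show ?thesis by simp
qed

text \<open>No information is lost: a part determines its block, written in decreasing order, and
  the increasing heads determine the order of the blocks.\<close>

lemma bij_betw_blocks_partitions:
  "bij_betw (\<lambda>L. set ` set L) (decreasing_blocks n) {P. partition_on {1..n} P}"
  unfolding bij_betw_def
proof
  show "inj_on (\<lambda>L. set ` set L) (decreasing_blocks n)"
  proof (rule inj_onI)
    fix L M assume L: "L \<in> decreasing_blocks n" and M: "M \<in> decreasing_blocks n"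
      and eq: "set ` set L = set ` set M"
    let ?r = "\<lambda>A. rev (sorted_list_of_set A) :: nat list"
    have r: "set N = ?r ` set ` set N" if "N \<in> decreasing_blocks n" for N
      using that decreasing_eq_rev_sorted_list_of_set
      by (force simp: decreasing_blocks_def image_image)
    have sets: "set L = set M" using r[OF L] r[OF M] eq by simp
    have sorted: "sorted_wrt (<) (map hd N)" if "N \<in> decreasing_blocks n" for N
      using that by (simp add: decreasing_blocks_def cycle_blocks_def sorted_wrt_map)
    have "inj_on hd (set L)"
      using sorted[OF L] by (simp add: strict_sorted_iff distinct_map)
    with sorted[OF L] sorted[OF M] sets show "L = M"
      by (intro map_sorted_distinct_set_unique[of hd]) (simp_all add: strict_sorted_iff)
  qed
  show "(\<lambda>L. set ` set L) ` decreasing_blocks n = {P. partition_on {1..n} P}"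
  proof (intro equalityI subsetI)
    fix P assume "P \<in> (\<lambda>L. set ` set L) ` decreasing_blocks n"
    then obtain L where P: "P = set ` set L" and L: "cycle_blocks L" "distinct (concat L)"
      "set (concat L) = {1..n}"
      by (auto simp: decreasing_blocks_def simp del: set_concat)
    have "disjoint P"
      using L(2) unfolding P distinct_concat_iff by (intro disjointI) blast
    moreover have "{} \<notin> P" using L(1) by (auto simp: P cycle_blocks_def)
    ultimately show "P \<in> {P. partition_on {1..n} P}"
      using L(3) by (simp add: P partition_on_def)
  next
    fix P assume "P \<in> {P. partition_on {1..n} P}"
    then have P: "partition_on {1..n} P" by simp
    have fin: "finite P" using finite_elements[OF _ P] by simp
    have U: "\<Union>P = {1..n}" and disj: "disjoint P" and ne: "{} \<notin> P"
      using P by (auto simp: partition_on_def)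
    have finA: "finite A" if "A \<in> P" for A
      using that U by (metis Sup_upper finite_atLeastAtMost finite_subset)
    obtain As where As: "set As = P" "distinct As" using finite_distinct_list[OF fin] by blast
    define r where "r = (\<lambda>A::nat set. rev (sorted_list_of_set A))"
    have set_r: "set (r A) = A" if "A \<in> P" for A using finA[OF that] by (simp add: r_def)
    have dec: "sorted_wrt (>) (r A)" for A
      by (simp add: r_def sorted_wrt_rev)
    have r_ne: "r A \<noteq> []" if "A \<in> P" for A using set_r[OF that] ne that by auto
    have hd_r: "hd (r A) \<in> A" if "A \<in> P" for A using set_r[OF that] r_ne[OF that] hd_in_set by metis
    \<comment> \<open>The head of a decreasing block is the maximum of its part, so the parts are
      sorted by maximum, starting from an arbitrary enumeration \<open>As\<close>.\<close>
    define L where "L = sort_key hd (map r As)"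
    have setL: "set L = r ` P" by (simp add: L_def As)
    have inj_r: "inj_on r P" by (rule inj_on_inverseI[of _ set]) (rule set_r)
    \<comment> \<open>Each head lies in its own part and the parts are disjoint. Distinct heads turn
      the weak order given by \<open>sort_key\<close> into the strict one required by
      \<open>cycle_blocks\<close>.\<close>
    have inj_hd: "inj_on hd (r ` P)"
    proof (rule inj_onI, elim imageE)
      fix c d A B assume "hd c = hd d" "c = r A" "d = r B" "A \<in> P" "B \<in> P"
      then have "A = B" using hd_r[of A] hd_r[of B] disj by (auto dest: disjointD)
      with \<open>c = r A\<close> \<open>d = r B\<close> show "c = d" by simp
    qed
    have distL: "distinct L" using As inj_r by (simp add: L_def distinct_map)
    have "sorted_wrt (<) (map hd L)"
      using distL inj_hd unfolding strict_sorted_iff by (simp add: distinct_map setL) (simp add: L_def)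
    moreover have "y \<le> hd c" if "c \<in> r ` P" "y \<in> set c" for c y
    proof -
      have "sorted_wrt (>) c" using that(1) dec by auto
      then show ?thesis using that(2) by (cases c) auto
    qed
    ultimately have "cycle_blocks L"
      using r_ne by (auto simp: cycle_blocks_def setL sorted_wrt_map)
    moreover have "distinct (concat L)"
    proof (rule distinct_concat[OF distL])
      show "distinct c" if "c \<in> set L" for c using that by (auto simp: setL r_def)
      show "set c \<inter> set d = {}" if cd: "c \<in> set L" "d \<in> set L" "c \<noteq> d" for c d
      proof -
        obtain A B where "A \<in> P" "B \<in> P" "c = r A" "d = r B" using cd by (auto simp: setL)
        with cd(3) set_r disjointD[OF disj, of A B] show ?thesis by auto
      qed
    qed
    moreover have "set (concat L) = {1..n}"
      using set_r U by (auto simp: setL)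
    moreover have "set ` set L = P"
      using set_r by (force simp: setL image_image)
    ultimately show "P \<in> (\<lambda>L. set ` set L) ` decreasing_blocks n"
      using dec
      by (intro image_eqI[of _ _ L]) (auto simp: decreasing_blocks_def setL simp del: set_concat)
  qed
qed

theorem theorem4p1:
  fixes n :: nat
  assumes "n \<ge> 1"
  shows "card (avoiders n ([3, 1], {(1, 2)})) = bell n"
  unfolding bell_def
  using bij_betw_same_card[OF bij_betw_concat_avoiders[of n]]
    bij_betw_same_card[OF bij_betw_blocks_partitions[of n]] by simp

end
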